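(* Let $1\le p<\infty$, let $u,\psi$ be entire functions on $\mathbb{C}$, and let the weighted composition operator $W_{(u,\psi)}$ be a compact power bounded operator on the Fock space $\mathcal{F}_p$, so that $\psi(z)=az+b$ with $a,b\in\mathbb{C}$, $|a|<1$. Let $u$ be non-vanishing on $\mathbb{C}$ and such that $u(z_0)=1$, where $z_0=\frac{b}{1-a}$. Then, in operator norm on $\mathcal{F}_p$, $$\lim_{n\to\infty}\Big\|\frac1n\sum_{k=1}^nW_{(u,\psi)}^k-W_{(u_\infty,z_0)}\Big\|=0,\qquad u_\infty(z)=\prod_{j=0}^\infty u(\psi^j(z)).$$
   Context: For $1\le p<\infty$, the Fock space $\mathcal{F}_p$ consists of all entire functions $f$ on $\mathbb{C}$ with $\|f\|_p=\Big(\frac{p}{2\pi}\int_{\mathbb{C}}|f(z)|^pe^{-\frac{p|z|^2}{2}}dA(z)\Big)^{1/p}<\infty$, where $dA$ is Lebesgue area measure. For entire $u,\psi$, the weighted composition operator is $W_{(u,\psi)}f=u\cdot (f\circ\psi)$. Here $\psi^j$ denotes the $j$-th iterate of $\psi$ under composition ($\psi^0$ is the identity map), the infinite product $u_\infty(z)$ is $\lim_{n\to\infty}\prod_{j=0}^{n-1}u(\psi^j(z))$, and $W_{(u_\infty,z_0)}$ is the weighted composition operator with constant symbol $z_0$, i.e. $W_{(u_\infty,z_0)}f=f(z_0)\,u_\infty$. A bounded operator $T$ on a Banach space is power bounded if $\sup_{n\in\mathbb{N}}\|T^n\|<\infty$. *)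

theory Defs
  imports "HOL-Analysis.Analysis"
begin

definition fock_space :: "real \<Rightarrow> (complex \<Rightarrow> complex) set" where
  "fock_space p = {f. f holomorphic_on UNIV \<and>
     integrable lborel (\<lambda>z. norm (f z) powr p * exp (- (p * (norm z)\<^sup>2 / 2)))}"

definition fock_norm :: "real \<Rightarrow> (complex \<Rightarrow> complex) \<Rightarrow> real" where
  "fock_norm p f =
     (p / (2 * pi) * (LINT z|lborel. norm (f z) powr p * exp (- (p * (norm z)\<^sup>2 / 2)))) powr (1 / p)"

definition fock_unit_ball :: "real \<Rightarrow> (complex \<Rightarrow> complex) set" where
  "fock_unit_ball p = {f \<in> fock_space p. fock_norm p f \<le> 1}"

definition fock_topology :: "real \<Rightarrow> (complex \<Rightarrow> complex) topology" where
  "fock_topology p =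
     Metric_space.mtopology (fock_space p) (\<lambda>f g. fock_norm p (\<lambda>z. f z - g z))"

text \<open>Operators on the Fock space are represented by functions on all of
  \<^typ>\<open>complex \<Rightarrow> complex\<close>; only their restriction to \<^const>\<open>fock_space\<close> matters below.\<close>

definition fock_bounded_operator ::
    "real \<Rightarrow> ((complex \<Rightarrow> complex) \<Rightarrow> (complex \<Rightarrow> complex)) \<Rightarrow> bool" where
  "fock_bounded_operator p T \<longleftrightarrow>
     (\<forall>f\<in>fock_space p. T f \<in> fock_space p) \<and>
     (\<forall>f\<in>fock_space p. \<forall>g\<in>fock_space p. T (\<lambda>z. f z + g z) = (\<lambda>z. T f z + T g z)) \<and>
     (\<forall>f\<in>fock_space p. \<forall>c. T (\<lambda>z. c * f z) = (\<lambda>z. c * T f z)) \<and>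
     (\<exists>C. \<forall>f\<in>fock_space p. fock_norm p (T f) \<le> C * fock_norm p f)"

text \<open>The supremum is taken in the reals, so it is the operator norm only for operators
  satisfying \<^const>\<open>fock_bounded_operator\<close>.\<close>

definition fock_opnorm ::
    "real \<Rightarrow> ((complex \<Rightarrow> complex) \<Rightarrow> (complex \<Rightarrow> complex)) \<Rightarrow> real" where
  "fock_opnorm p T = (SUP f\<in>fock_unit_ball p. fock_norm p (T f))"

definition fock_compact_operator ::
    "real \<Rightarrow> ((complex \<Rightarrow> complex) \<Rightarrow> (complex \<Rightarrow> complex)) \<Rightarrow> bool" where
  "fock_compact_operator p T \<longleftrightarrow> fock_bounded_operator p T \<and>
     compactin (fock_topology p) (fock_topology p closure_of (T ` fock_unit_ball p))"

definition fock_power_bounded ::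
    "real \<Rightarrow> ((complex \<Rightarrow> complex) \<Rightarrow> (complex \<Rightarrow> complex)) \<Rightarrow> bool" where
  "fock_power_bounded p T \<longleftrightarrow> fock_bounded_operator p T \<and>
     bdd_above (range (\<lambda>n. fock_opnorm p (T ^^ n)))"

definition weighted_comp ::
    "(complex \<Rightarrow> complex) \<Rightarrow> (complex \<Rightarrow> complex) \<Rightarrow> (complex \<Rightarrow> complex) \<Rightarrow> (complex \<Rightarrow> complex)" where
  "weighted_comp u \<psi> f = (\<lambda>z. u z * f (\<psi> z))"

text \<open>The infinite product is the plain limit of its partial products (no condition that the
  limit be nonzero), hence \<^const>\<open>lim\<close> rather than \<^const>\<open>prodinf\<close>.\<close>

definition u_infinity :: "(complex \<Rightarrow> complex) \<Rightarrow> (complex \<Rightarrow> complex) \<Rightarrow> complex \<Rightarrow> complex" where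
  "u_infinity u \<psi> z = lim (\<lambda>n. \<Prod>j<n. u ((\<psi> ^^ j) z))"

end

theory Submission
  imports Defs "HOL-Complex_Analysis.Complex_Analysis"
begin

text \<open>Write \<open>T\<close> for the weighted composition operator and \<open>P f = f(z0) u\<^sub>\<infinity>\<close>. Since \<open>z0\<close> attracts every
  orbit of \<open>\<psi>\<close> geometrically and \<open>u(z0) = 1\<close>, \<open>T\<^sup>n f \<rightarrow> P f\<close> pointwise. Power boundedness puts
  \<open>T\<^sup>n\<^sup>+\<^sup>1 f = T (T\<^sup>n f)\<close> into a multiple of the compact closure of the image of the unit ball, and norm
  convergence implies pointwise convergence because point evaluations are bounded; hence
  \<open>T\<^sup>n f \<rightarrow> P f\<close> in norm, which also shows \<open>u\<^sub>\<infinity> \<in> F\<^sub>p\<close> (take \<open>f = 1\<close>). As \<open>P T = P\<close>, we have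
  \<open>T\<^sup>n\<^sup>+\<^sup>1 - P = (T\<^sup>n - P) T\<close>, so compactness upgrades strong to operator norm convergence of
  the powers themselves, hence of their Cesaro means. Boundedness of point evaluations comes
  from averaging the circle mean value property over a disc, using that area measure is
  rotation invariant.\<close>

section \<open>Area measure on the complex plane and its rotation invariance\<close>

text \<open>Lebesgue measure is determined by its values on boxes, and a complex box is a product of
  two real intervals. This gives access to Tonelli's theorem in real coordinates.\<close>

lemma lborel_complex_eq:
  "lborel = distr (lborel \<Otimes>\<^sub>M lborel) borel (\<lambda>(x, y). Complex x y)"
proof (rule lborel_eqI)
  have meas [measurable]: "(\<lambda>(x, y). Complex x y) \<in> borel_measurable (lborel \<Otimes>\<^sub>M lborel)"
    by (simp add: lborel_prod case_prod_beta' borel_measurable_continuous_onI continuous_intros)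
  fix l u :: complex
  assume le: "\<And>b. b \<in> Basis \<Longrightarrow> l \<bullet> b \<le> u \<bullet> b"
  have le': "Re l \<le> Re u" "Im l \<le> Im u"
    using le[of 1] le[of \<i>] by simp_all
  have "(\<lambda>(x, y). Complex x y) -` box l u = {Re l<..<Re u} \<times> {Im l<..<Im u}"
    by (auto simp: in_box_complex_iff)
  then show "emeasure (distr (lborel \<Otimes>\<^sub>M lborel) borel (\<lambda>(x, y). Complex x y)) (box l u)
      = ennreal (\<Prod>b\<in>Basis. (u - l) \<bullet> b)"
    using le' by (simp add: emeasure_distr space_pair_measure lborel.emeasure_pair_measure_Times
        Basis_complex_def ennreal_mult)
qed simp

text \<open>Both orders of integration are recorded because the rotation argument substitutes first
  in \<open>x\<close> and then in \<open>y\<close>.\<close>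

lemma nn_integral_lborel_complex:
  assumes [measurable]: "g \<in> borel_measurable borel"
  shows "(\<integral>\<^sup>+z. g z \<partial>lborel) = (\<integral>\<^sup>+x. \<integral>\<^sup>+y. g (Complex x y) \<partial>lborel \<partial>lborel)"
    and "(\<integral>\<^sup>+z. g z \<partial>lborel) = (\<integral>\<^sup>+y. \<integral>\<^sup>+x. g (Complex x y) \<partial>lborel \<partial>lborel)"
proof -
  have meas [measurable]: "(\<lambda>(x, y). Complex x y) \<in> borel_measurable (lborel \<Otimes>\<^sub>M lborel)"
    by (simp add: lborel_prod case_prod_beta' borel_measurable_continuous_onI continuous_intros)
  have meas' [measurable]: "(\<lambda>(x, y). g (Complex x y)) \<in> borel_measurable (lborel \<Otimes>\<^sub>M lborel)"
    using measurable_compose[OF meas assms] by (simp add: case_prod_beta')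
  have "(\<integral>\<^sup>+z. g z \<partial>lborel) = (\<integral>\<^sup>+(x, y). g (Complex x y) \<partial>(lborel \<Otimes>\<^sub>M lborel))"
    by (subst lborel_complex_eq, subst nn_integral_distr) (auto simp: case_prod_beta')
  then show "(\<integral>\<^sup>+z. g z \<partial>lborel) = (\<integral>\<^sup>+x. \<integral>\<^sup>+y. g (Complex x y) \<partial>lborel \<partial>lborel)"
    "(\<integral>\<^sup>+z. g z \<partial>lborel) = (\<integral>\<^sup>+y. \<integral>\<^sup>+x. g (Complex x y) \<partial>lborel \<partial>lborel)"
    using lborel.nn_integral_fst[OF meas'] lborel_pair.nn_integral_snd[OF meas'] by simp_all
qed

lemma borel_measurable_Complex [measurable (raw)]:
  assumes "f \<in> borel_measurable M" "g \<in> borel_measurable M"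
  shows "(\<lambda>x. Complex (f x) (g x)) \<in> borel_measurable M"
  unfolding Complex_eq using assms by measurable

text \<open>The rotation matrix with nonzero entry \<^term>\<open>Re c\<close> is eliminated by one substitution
  in each coordinate, with factors \<open>1 / \<bar>Re c\<bar>\<close> and \<open>\<bar>Re c\<bar>\<close>.\<close>

lemma nn_integral_lborel_rotate_aux:
  fixes g :: "complex \<Rightarrow> ennreal"
  assumes [measurable]: "g \<in> borel_measurable borel" and c: "norm c = 1" "Re c \<noteq> 0"
  shows "(\<integral>\<^sup>+z. g (c * z) \<partial>lborel) = (\<integral>\<^sup>+z. g z \<partial>lborel)"
proof -
  define a s where "a = Re c" and "s = Im c"
  have as: "a\<^sup>2 + s\<^sup>2 = 1" "a \<noteq> 0"
    using c by (simp_all add: a_def s_def cmod_def)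
  have rot: "c * Complex x y = Complex (a * x - s * y) (a * y + s * x)" for x y
    by (simp add: a_def s_def complex_eq_iff)
  have "(\<integral>\<^sup>+z. g (c * z) \<partial>lborel)
      = (\<integral>\<^sup>+y. \<integral>\<^sup>+x. g (Complex (a * x - s * y) (a * y + s * x)) \<partial>lborel \<partial>lborel)"
    by (subst nn_integral_lborel_complex(2)) (simp_all add: rot)
  \<comment> \<open>The new inner variable is the first coordinate \<open>a * x - s * y\<close>. By
    \<open>a\<^sup>2 + s\<^sup>2 = 1\<close> the second coordinate becomes
    \<open>y / a + s * x / a\<close>, so what remains is a scaled shear in \<open>y\<close> alone,
    removable once the integrals are swapped.\<close>
  also have "\<dots> = (\<integral>\<^sup>+y. \<bar>1 / a\<bar> * (\<integral>\<^sup>+x. g (Complex x (y / a + s * x / a)) \<partial>lborel) \<partial>lborel)"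
  proof (rule nn_integral_cong)
    fix y :: real
    have *: "a * (s * y / a + x / a) - s * y = x"
        "a * y + s * (s * y / a + x / a) = y / a + s * x / a" for x
    proof -
      show "a * (s * y / a + x / a) - s * y = x"
        using as(2) by (simp add: field_simps)
      have "a * y + s * (s * y / a + x / a) = (a\<^sup>2 + s\<^sup>2) * y / a + s * x / a"
        using as(2) by (simp add: field_simps power2_eq_square)
      then show "a * y + s * (s * y / a + x / a) = y / a + s * x / a"
        using as by simp
    qed
    show "(\<integral>\<^sup>+x. g (Complex (a * x - s * y) (a * y + s * x)) \<partial>lborel)
        = \<bar>1 / a\<bar> * (\<integral>\<^sup>+x. g (Complex x (y / a + s * x / a)) \<partial>lborel)"
      by (subst nn_integral_real_affine[where c="1 / a" and t="s * y / a"])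
        (use as(2) in \<open>simp_all add: * del: abs_divide\<close>)
  qed
  also have "\<dots> = \<bar>1 / a\<bar> * (\<integral>\<^sup>+y. \<integral>\<^sup>+x. g (Complex x (y / a + s * x / a)) \<partial>lborel \<partial>lborel)"
    by (subst nn_integral_cmult) simp_all
  also have "(\<integral>\<^sup>+y. \<integral>\<^sup>+x. g (Complex x (y / a + s * x / a)) \<partial>lborel \<partial>lborel)
      = (\<integral>\<^sup>+x. \<integral>\<^sup>+y. g (Complex x (y / a + s * x / a)) \<partial>lborel \<partial>lborel)"
    by (rule lborel_pair.Fubini') simp
  also have "\<dots> = (\<integral>\<^sup>+x. \<bar>a\<bar> * (\<integral>\<^sup>+y. g (Complex x y) \<partial>lborel) \<partial>lborel)"
  proof (rule nn_integral_cong)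
    fix x :: real
    have *: "(a * y - s * x) / a + s * x / a = y" for y
      using as(2) by (simp add: field_simps)
    show "(\<integral>\<^sup>+y. g (Complex x (y / a + s * x / a)) \<partial>lborel) = \<bar>a\<bar> * (\<integral>\<^sup>+y. g (Complex x y) \<partial>lborel)"
      by (subst nn_integral_real_affine[where c=a and t="- s * x"]) (use as(2) in \<open>simp_all add: *\<close>)
  qed
  also have "\<dots> = \<bar>a\<bar> * (\<integral>\<^sup>+z. g z \<partial>lborel)"
    by (subst nn_integral_cmult) (simp_all add: nn_integral_lborel_complex(1))
  also have "\<bar>1 / a\<bar> * (\<bar>a\<bar> * (\<integral>\<^sup>+z. g z \<partial>lborel)) = (\<integral>\<^sup>+z. g z \<partial>lborel)"
    using as(2) by (simp add: mult.assoc[symmetric] ennreal_mult[symmetric])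
  finally show ?thesis .
qed

text \<open>With \<open>d\<close> a square root of \<open>c\<close>, the case of nonzero real part
  is applied twice to \<open>d\<close>. If \<open>d\<close> is purely imaginary, then
  \<open>c = -1\<close>, and the case applies to \<open>c\<close> itself.\<close>

lemma nn_integral_lborel_rotate:
  fixes g :: "complex \<Rightarrow> ennreal"
  assumes [measurable]: "g \<in> borel_measurable borel" and c: "norm c = 1"
  shows "(\<integral>\<^sup>+z. g (c * z) \<partial>lborel) = (\<integral>\<^sup>+z. g z \<partial>lborel)"
proof -
  define d where "d = csqrt c"
  have d: "d * d = c" "norm d = 1"
    using c by (simp_all add: d_def flip: power2_eq_square)
  show ?thesis
  proof (cases "Re d = 0")
    case False
    have "(\<integral>\<^sup>+z. g (c * z) \<partial>lborel) = (\<integral>\<^sup>+z. g (d * (d * z)) \<partial>lborel)"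
      by (simp add: d(1) flip: mult.assoc)
    also have "\<dots> = (\<integral>\<^sup>+z. g (d * z) \<partial>lborel)"
      by (rule nn_integral_lborel_rotate_aux) (use d False in auto)
    also have "\<dots> = (\<integral>\<^sup>+z. g z \<partial>lborel)"
      by (rule nn_integral_lborel_rotate_aux) (use d False in auto)
    finally show ?thesis .
  next
    case True
    then have "Re c \<noteq> 0"
      using d by (auto simp: cmod_def simp flip: d(1))
    then show ?thesis
      using c by (intro nn_integral_lborel_rotate_aux) auto
  qed
qed

section \<open>Mean value inequality on circles and discs\<close>

text \<open>Cauchy's formula at \<open>0\<close> for the entire function
  \<open>v \<mapsto> f (z + v * w)\<close> on the unit circle. Parametrising by \<open>t\<close> in
  \<open>{0..1}\<close> makes the integral an average without further normalisation.\<close>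

lemma norm_le_circle_nn_integral:
  fixes f :: "complex \<Rightarrow> complex"
  assumes f: "f holomorphic_on UNIV"
  shows "ennreal (norm (f z)) \<le> (\<integral>\<^sup>+t. ennreal (norm (f (z + cis (2 * pi * t) * w))) * indicator {0..1} t \<partial>lborel)"
proof -
  define F where "F v = f (z + v * w)" for v
  have F: "F holomorphic_on UNIV"
    unfolding F_def by (rule holomorphic_on_compose_gen[OF _ f, unfolded o_def])
      (auto intro!: holomorphic_intros)
  have contF: "continuous_on UNIV F"
    using F holomorphic_on_imp_continuous_on by blast
  have "((\<lambda>u. F u / (u - 0)) has_contour_integral (2 * of_real pi * \<i> * F 0)) (circlepath 0 1)"
    by (rule Cauchy_integral_circlepath_simple) (use F holomorphic_on_subset in auto)
  then have "((\<lambda>t. 2 * of_real pi * \<i> * F (cis (2 * pi * t))) has_integral (2 * of_real pi * \<i> * F 0)) {0..1}"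
    unfolding has_contour_integral_def
  proof (rule has_integral_eq[rotated])
    fix t :: real assume t: "t \<in> {0..1}"
    have "circlepath 0 1 t = cis (2 * pi * t)"
      by (simp add: circlepath cis_conv_exp mult_ac)
    moreover have "vector_derivative (circlepath 0 1) (at t within {0..1}) = 2 * of_real pi * \<i> * cis (2 * pi * t)"
      using t by (simp add: vector_derivative_circlepath01 cis_conv_exp mult_ac)
    ultimately show "F (circlepath 0 1 t) / (circlepath 0 1 t - 0) * vector_derivative (circlepath 0 1) (at t within {0..1})
        = 2 * of_real pi * \<i> * F (cis (2 * pi * t))"
      by simp
  qed
  then have "((\<lambda>t. (1 / (2 * of_real pi * \<i>)) * (2 * of_real pi * \<i> * F (cis (2 * pi * t))))
       has_integral (1 / (2 * of_real pi * \<i>)) * (2 * of_real pi * \<i> * F 0)) {0..1}"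
    by (rule has_integral_mult_right)
  then have int: "((\<lambda>t. F (cis (2 * pi * t))) has_integral F 0) {0..1}"
    by simp
  have cont: "continuous_on UNIV (\<lambda>t. F (cis (2 * pi * t)))"
    by (intro continuous_on_compose2[OF contF] continuous_intros) auto
  have "norm (F 0) \<le> integral {0..1} (\<lambda>t. norm (F (cis (2 * pi * t))))"
    unfolding integral_unique[OF int, symmetric]
  proof (rule integral_norm_bound_integral)
    show "(\<lambda>t. norm (F (cis (2 * pi * t)))) integrable_on {0..1}"
      by (intro integrable_continuous_interval continuous_on_norm continuous_on_subset[OF cont]) auto
  qed (use int in \<open>auto simp: has_integral_integrable\<close>)
  moreover have "(\<integral>\<^sup>+t. ennreal (norm (F (cis (2 * pi * t)))) * indicator {0..1} t \<partial>lborel)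
      = ennreal (integral {0..1} (\<lambda>t. norm (F (cis (2 * pi * t)))))"
  proof (rule nn_integral_has_integral_lebesgue')
    show "((\<lambda>t. norm (F (cis (2 * pi * t)))) has_integral integral {0..1} (\<lambda>t. norm (F (cis (2 * pi * t))))) {0..1}"
      by (intro integrable_integral integrable_continuous_interval continuous_on_norm
          continuous_on_subset[OF cont]) auto
  qed auto
  ultimately show ?thesis
    by (metis (no_types, lifting) F_def ennreal_leI mult_zero_left add_0_right nn_integral_cong)
qed

text \<open>The circle inequality is integrated over all \<open>w\<close> in the disc. After
  swapping the integrals, rotation invariance makes the inner integral independent of
  \<open>t\<close>.\<close>

lemma norm_le_disc_nn_integral:
  fixes f :: "complex \<Rightarrow> complex"
  assumes f: "f holomorphic_on UNIV"
  shows "ennreal (norm (f z)) * emeasure lborel (cball 0 1 :: complex set)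
    \<le> (\<integral>\<^sup>+w. norm (f (z + w)) * indicator (cball 0 1) w \<partial>lborel)"
proof -
  have [measurable]: "f \<in> borel_measurable borel"
    using f holomorphic_on_imp_continuous_on borel_measurable_continuous_onI by blast
  have [measurable]: "cis \<in> borel_measurable borel"
    by (intro borel_measurable_continuous_onI continuous_intros)
  have [measurable]: "(cball 0 1 :: complex set) \<in> sets borel"
    by simp
  \<comment> \<open>The cutoff to the disc is part of \<open>h\<close>; since the disc is rotation
    invariant, \<open>h\<close> at a rotated point carries the same cutoff.\<close>
  define h where "h w = ennreal (norm (f (z + w)) * indicator (cball 0 1) w)" for w
  have h [measurable]: "h \<in> borel_measurable borel"
    unfolding h_def by measurable
  have "ennreal (norm (f z)) * emeasure lborel (cball 0 1 :: complex set)
      = (\<integral>\<^sup>+w. ennreal (norm (f z)) * indicator (cball 0 1 :: complex set) w \<partial>lborel)"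
    by (subst nn_integral_cmult) simp_all
  also have "\<dots> \<le> (\<integral>\<^sup>+w. \<integral>\<^sup>+t. h (cis (2 * pi * t) * w) * indicator {0..1} t \<partial>lborel \<partial>lborel)"
  proof (rule nn_integral_mono)
    fix w :: complex
    show "ennreal (norm (f z)) * indicator (cball 0 1 :: complex set) w
      \<le> (\<integral>\<^sup>+t. h (cis (2 * pi * t) * w) * indicator {0..1} t \<partial>lborel)"
    proof (cases "w \<in> cball 0 1")
      case True
      have "h (cis (2 * pi * t) * w) * indicator {0..1} t
          = ennreal (norm (f (z + cis (2 * pi * t) * w))) * indicator {0..1} t" for t
        using True by (simp add: h_def norm_mult indicator_def)
      then show ?thesis
        using True norm_le_circle_nn_integral[OF f, of z w] by simp
    qed simp
  qed
  also have "\<dots> = (\<integral>\<^sup>+t. \<integral>\<^sup>+w. h (cis (2 * pi * t) * w) * indicator {0..1} t \<partial>lborel \<partial>lborel)"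
    by (rule lborel_pair.Fubini') simp
  also have "\<dots> = (\<integral>\<^sup>+t. (\<integral>\<^sup>+w. h w \<partial>lborel) * indicator {0..1::real} t \<partial>lborel)"
  proof (rule nn_integral_cong)
    fix t :: real
    have "(\<integral>\<^sup>+w. h (cis (2 * pi * t) * w) * indicator {0..1} t \<partial>lborel)
        = (\<integral>\<^sup>+w. h (cis (2 * pi * t) * w) \<partial>lborel) * indicator {0..1} t"
      by (rule nn_integral_multc) simp
    also have "(\<integral>\<^sup>+w. h (cis (2 * pi * t) * w) \<partial>lborel) = (\<integral>\<^sup>+w. h w \<partial>lborel)"
      by (rule nn_integral_lborel_rotate) simp_all
    finally show "(\<integral>\<^sup>+w. h (cis (2 * pi * t) * w) * indicator {0..1} t \<partial>lborel)
        = (\<integral>\<^sup>+w. h w \<partial>lborel) * indicator {0..1} t" .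
  qed
  also have "\<dots> = (\<integral>\<^sup>+w. h w \<partial>lborel)"
    by (simp add: nn_integral_cmult)
  finally show ?thesis
    by (simp add: h_def)
qed

section \<open>The Fock norm and Minkowski's inequality\<close>

text \<open>Convexity of the \<open>p\<close>-th power: \<open>(x + y) / (a + b)\<close> is the
  convex combination of \<open>x / a\<close> and \<open>y / b\<close> with weights proportional to
  \<open>a\<close> and \<open>b\<close>. With \<open>a\<close> and \<open>b\<close> close to the
  norms of two functions this integrates to Minkowski's inequality.\<close>

lemma powr_add_le_weighted:
  fixes x y a b p :: real
  assumes p: "1 \<le> p" and xy: "0 \<le> x" "0 \<le> y" and ab: "0 < a" "0 < b"
  shows "(x + y) powr p \<le> (a + b) powr p * (a / (a + b) * (x / a) powr p + b / (a + b) * (y / b) powr p)"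
proof -
  define l where "l = a / (a + b)"
  have l: "0 < l" "l < 1" and l': "1 - l = b / (a + b)"
    using ab by (auto simp: l_def field_simps)
  define X Y where "X = x / a" and "Y = y / b"
  have XY: "0 \<le> X" "0 \<le> Y"
    using xy ab by (auto simp: X_def Y_def)
  \<comment> \<open>Convexity is invoked only for positive \<open>X\<close> and \<open>Y\<close>;
    when one of them vanishes, the claim reduces to this estimate for the weight of the
    other.\<close>
  have shrink: "m powr p \<le> m" if "0 < m" "m < 1" for m
    using powr_mono'[of 1 p m] that p by simp
  have "(l * X + (1 - l) * Y) powr p \<le> l * X powr p + (1 - l) * Y powr p"
  proof (cases "X = 0 \<or> Y = 0")
    case True
    then show ?thesis
      using XY l shrink[of l] shrink[of "1 - l"] p by (auto simp: powr_mult mult_right_mono)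
  next
    case False
    then show ?thesis
      using convex_onD[OF powr_convex[OF p], of "1 - l" X Y] XY l by simp
  qed
  moreover have "x + y = (a + b) * (l * X + (1 - l) * Y)"
  proof -
    have "l * X = x / (a + b)" "(1 - l) * Y = y / (a + b)"
      unfolding l' using ab by (simp_all add: l_def X_def Y_def)
    then show ?thesis
      using ab by (simp flip: add_divide_distrib)
  qed
  moreover have "0 \<le> l * X + (1 - l) * Y"
    using XY l by simp
  ultimately have "(x + y) powr p \<le> (a + b) powr p * (l * X powr p + (1 - l) * Y powr p)"
    using ab by (simp add: powr_mult mult_left_mono)
  then show ?thesis
    unfolding l' by (simp only: l_def X_def Y_def)
qed

definition fock_density :: "real \<Rightarrow> (complex \<Rightarrow> complex) \<Rightarrow> complex \<Rightarrow> real" where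
  "fock_density p f z = norm (f z) powr p * exp (- (p * (norm z)\<^sup>2 / 2))"

lemma fock_norm_density:
  "fock_norm p f = (p / (2 * pi) * (LINT z|lborel. fock_density p f z)) powr (1 / p)"
  by (simp add: fock_norm_def fock_density_def)

lemma fock_space_iff: "f \<in> fock_space p \<longleftrightarrow> f holomorphic_on UNIV \<and> integrable lborel (fock_density p f)"
  by (simp add: fock_space_def fock_density_def[abs_def])

lemma fock_density_nonneg [simp]: "0 \<le> fock_density p f z"
  by (simp add: fock_density_def)

lemma fock_norm_nonneg [simp]: "0 \<le> fock_norm p f"
  by (simp add: fock_norm_def)

lemma fock_norm_powr:
  assumes "1 \<le> p"
  shows "fock_norm p f powr p = p / (2 * pi) * (LINT z|lborel. fock_density p f z)"
  using assms by (simp add: fock_norm_def fock_density_def[abs_def] powr_powr)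

lemma borel_measurable_holomorphic:
  "f holomorphic_on UNIV \<Longrightarrow> f \<in> borel_measurable borel"
  using holomorphic_on_imp_continuous_on borel_measurable_continuous_onI by blast

lemma fock_density_measurable [measurable]:
  assumes [measurable]: "f \<in> borel_measurable borel"
  shows "fock_density p f \<in> borel_measurable borel"
  unfolding fock_density_def[abs_def] by measurable

lemma fock_density_cmult:
  "fock_density p (\<lambda>z. c * f z) = (\<lambda>z. norm c powr p * fock_density p f z)"
  by (simp add: fock_density_def[abs_def] norm_mult powr_mult mult_ac)

lemma fock_space_cmult: "f \<in> fock_space p \<Longrightarrow> (\<lambda>z. c * f z) \<in> fock_space p"
  by (auto simp: fock_space_iff fock_density_cmult intro!: holomorphic_intros)

lemma fock_norm_cmult:
  assumes "1 \<le> p"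
  shows "fock_norm p (\<lambda>z. c * f z) = norm c * fock_norm p f"
proof -
  have "p / (2 * pi) * (norm c powr p * I) = norm c powr p * (p / (2 * pi) * I)" for I
    by simp
  then show ?thesis
    using assms by (simp only: fock_norm_density fock_density_cmult integral_mult_right_zero powr_mult)
      (simp add: powr_powr)
qed

lemma fock_norm_zero [simp]: "fock_norm p (\<lambda>z. 0) = 0"
  by (simp add: fock_norm_def)

lemma fock_space_zero [simp]: "(\<lambda>z. 0) \<in> fock_space p"
  by (simp add: fock_space_def)

lemma fock_density_add_le:
  assumes "1 \<le> p" "0 < a" "0 < b"
  shows "fock_density p (\<lambda>z. f z + g z) z \<le> (a + b) powr p *
    (a / (a + b) / a powr p * fock_density p f z + b / (a + b) / b powr p * fock_density p g z)"
proof -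
  have "norm (f z + g z) powr p \<le> (norm (f z) + norm (g z)) powr p"
    using assms by (intro powr_mono2 norm_triangle_ineq) auto
  also have "\<dots> \<le> (a + b) powr p *
      (a / (a + b) * (norm (f z) / a) powr p + b / (a + b) * (norm (g z) / b) powr p)"
    using assms by (intro powr_add_le_weighted) auto
  finally have "norm (f z + g z) powr p * exp (- (p * (norm z)\<^sup>2 / 2)) \<le> (a + b) powr p *
      (a / (a + b) * (norm (f z) / a) powr p + b / (a + b) * (norm (g z) / b) powr p)
      * exp (- (p * (norm z)\<^sup>2 / 2))"
    by (rule mult_right_mono) simp
  moreover have "c * (norm w / d) powr p = c / d powr p * norm w powr p" if "0 < d" for c d and w :: complex
    using that by (simp add: powr_divide)
  ultimately show ?thesis
    using assms unfolding fock_density_def by (simp only: distrib_right mult.assoc)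
qed

lemma fock_space_add:
  assumes p: "1 \<le> p" and f: "f \<in> fock_space p" and g: "g \<in> fock_space p"
  shows "(\<lambda>z. f z + g z) \<in> fock_space p"
proof -
  have hol: "(\<lambda>z. f z + g z) holomorphic_on UNIV"
    using f g by (auto simp: fock_space_iff intro!: holomorphic_intros)
  \<comment> \<open>The pointwise estimate with \<open>a = b = 1\<close>; the sums stay unevaluated
    so that the majorant matches it literally.\<close>
  let ?B = "\<lambda>z. (1 + 1) powr p *
    (1 / (1 + 1) / 1 powr p * fock_density p f z + 1 / (1 + 1) / 1 powr p * fock_density p g z)"
  have "integrable lborel (fock_density p (\<lambda>z. f z + g z))"
  proof (rule Bochner_Integration.integrable_bound)
    show "integrable lborel ?B"
      using f g by (auto simp: fock_space_iff)
    show "AE z in lborel. norm (fock_density p (\<lambda>z. f z + g z) z) \<le> norm (?B z)"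
      using fock_density_add_le[OF p, of 1 1 f g] by (auto simp del: one_add_one)
  qed (use borel_measurable_holomorphic[OF hol] in measurable)
  with hol show ?thesis
    by (simp add: fock_space_iff)
qed

text \<open>Integrating the weighted convexity estimate with \<open>a\<close> and \<open>b\<close>
  slightly above the two norms bounds the norm of the sum by \<open>a + b\<close>. The extra
  \<open>e / 2\<close> keeps \<open>a\<close> and \<open>b\<close> positive even for functions of
  norm zero.\<close>

lemma fock_norm_triangle:
  assumes p: "1 \<le> p" and f: "f \<in> fock_space p" and g: "g \<in> fock_space p"
  shows "fock_norm p (\<lambda>z. f z + g z) \<le> fock_norm p f + fock_norm p g"
proof (rule field_le_epsilon)
  fix e :: real assume e: "0 < e"
  define a b where "a = fock_norm p f + e / 2" and "b = fock_norm p g + e / 2"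
  have ab: "0 < a" "0 < b"
    using e fock_norm_nonneg[of p f] fock_norm_nonneg[of p g]
    by (auto simp: a_def b_def intro: add_nonneg_pos simp del: fock_norm_nonneg)
  \<comment> \<open>These are the \<open>p\<close>-th powers of the norms of \<open>f / a\<close>
    and \<open>g / b\<close>.\<close>
  have le: "p / (2 * pi) * (LINT z|lborel. fock_density p f z) / a powr p \<le> 1"
      "p / (2 * pi) * (LINT z|lborel. fock_density p g z) / b powr p \<le> 1"
    using p e ab powr_mono2[of p "fock_norm p f" a] powr_mono2[of p "fock_norm p g" b]
    unfolding fock_norm_powr[OF p, symmetric] by (simp_all add: a_def b_def)
  have "(LINT z|lborel. fock_density p (\<lambda>z. f z + g z) z) \<le>
      (LINT z|lborel. (a + b) powr p *
    (a / (a + b) / a powr p * fock_density p f z + b / (a + b) / b powr p * fock_density p g z))"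
    using f g fock_space_add[OF p f g] fock_density_add_le[OF p ab]
    by (intro integral_mono) (auto simp: fock_space_iff)
  also have "\<dots> = (a + b) powr p * (a / (a + b) / a powr p * (LINT z|lborel. fock_density p f z)
      + b / (a + b) / b powr p * (LINT z|lborel. fock_density p g z))"
    using f g by (simp add: fock_space_iff)
  finally have "fock_norm p (\<lambda>z. f z + g z) powr p \<le> p / (2 * pi) *
      ((a + b) powr p * (a / (a + b) / a powr p * (LINT z|lborel. fock_density p f z)
      + b / (a + b) / b powr p * (LINT z|lborel. fock_density p g z)))"
    using p unfolding fock_norm_powr[OF p] by (intro mult_left_mono) auto
  also have "\<dots> = (a + b) powr p *
      (a / (a + b) * (p / (2 * pi) * (LINT z|lborel. fock_density p f z) / a powr p)
       + b / (a + b) * (p / (2 * pi) * (LINT z|lborel. fock_density p g z) / b powr p))"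
    by (simp add: algebra_simps)
  also have "\<dots> \<le> (a + b) powr p * (a / (a + b) * 1 + b / (a + b) * 1)"
    using ab le by (intro mult_left_mono add_mono) auto
  also have "\<dots> = (a + b) powr p"
    using ab by (simp add: add_divide_distrib[symmetric])
  finally have "fock_norm p (\<lambda>z. f z + g z) \<le> a + b"
    using p ab powr_less_mono2[of p "a + b" "fock_norm p (\<lambda>z. f z + g z)"] by force
  then show "fock_norm p (\<lambda>z. f z + g z) \<le> fock_norm p f + fock_norm p g + e"
    by (simp add: a_def b_def)
qed

lemma fock_space_diff:
  assumes "1 \<le> p" "f \<in> fock_space p" "g \<in> fock_space p"
  shows "(\<lambda>z. f z - g z) \<in> fock_space p"
  using fock_space_add[OF assms(1,2) fock_space_cmult[OF assms(3), of "-1"]] by simp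

lemma fock_norm_commute: "fock_norm p (\<lambda>z. f z - g z) = fock_norm p (\<lambda>z. g z - f z)"
  by (simp add: fock_norm_def norm_minus_commute)

lemma fock_norm_diff_triangle:
  assumes "1 \<le> p" "f \<in> fock_space p" "g \<in> fock_space p"
  shows "fock_norm p (\<lambda>z. f z - g z) \<le> fock_norm p f + fock_norm p g"
  using fock_norm_triangle[OF assms(1,2) fock_space_cmult[OF assms(3), of "-1"]]
    fock_norm_cmult[OF assms(1), of "-1" g] by simp

section \<open>Point evaluations and the metric of the Fock space\<close>

text \<open>On the unit disc around \<open>z\<close> the Gaussian weight is at least the reciprocal
  of the exponential factor. The elementary bound \<open>x \<le> 1 + x powr p\<close> takes the
  place of Hoelder's inequality, at the price of the inhomogeneous term \<open>v\<close>.\<close>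

lemma norm_times_disc_le:
  assumes p: "1 \<le> p" and f: "f \<in> fock_space p"
  defines "v \<equiv> measure lborel (cball 0 1 :: complex set)"
  shows "norm (f z) * v \<le> v + exp (p * (norm z + 1)\<^sup>2 / 2) * (LINT z|lborel. fock_density p f z)"
proof -
  let ?K = "exp (p * (norm z + 1)\<^sup>2 / 2)"
  have hol: "f holomorphic_on UNIV" and int: "integrable lborel (fock_density p f)"
    using f by (auto simp: fock_space_iff)
  have [measurable]: "f \<in> borel_measurable borel"
    using hol by (rule borel_measurable_holomorphic)
  have [measurable]: "(cball 0 1 :: complex set) \<in> sets borel"
    by simp
  have v: "emeasure lborel (cball 0 1 :: complex set) = ennreal v"
    unfolding v_def by (rule emeasure_eq_ennreal_measure) (use emeasure_lborel_cball_finite[of "0::complex" 1] in auto)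
  have I0: "0 \<le> (LINT z|lborel. fock_density p f z)"
    by simp
  have "ennreal (norm (f z)) * ennreal v \<le> (\<integral>\<^sup>+w. norm (f (z + w)) * indicator (cball 0 1) w \<partial>lborel)"
    using norm_le_disc_nn_integral[OF hol, of z] by (simp add: v)
  also have "\<dots> \<le> (\<integral>\<^sup>+w. indicator (cball 0 1) w + ennreal ?K * ennreal (fock_density p f (z + w)) \<partial>lborel)"
  proof (rule nn_integral_mono)
    fix w :: complex
    show "ennreal (norm (f (z + w)) * indicator (cball 0 1) w)
      \<le> indicator (cball 0 1) w + ennreal ?K * ennreal (fock_density p f (z + w))"
    proof (cases "w \<in> cball 0 1")
      case True
      have x: "x \<le> 1 + x powr p" if "0 \<le> x" for x :: real
        using that p powr_mono[of 1 p x] by (cases "x \<le> 1") (auto intro: add_increasing2)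
      have "norm (z + w) \<le> norm z + 1"
        using True norm_triangle_le[of z w] by (simp add: norm_triangle_le)
      then have "(norm (z + w))\<^sup>2 \<le> (norm z + 1)\<^sup>2"
        by (intro power_mono) auto
      then have "1 \<le> ?K * exp (- (p * (norm (z + w))\<^sup>2 / 2))"
        using p by (simp flip: exp_add) 
      then have "norm (f (z + w)) powr p * 1 \<le> norm (f (z + w)) powr p * (?K * exp (- (p * (norm (z + w))\<^sup>2 / 2)))"
        by (intro mult_left_mono) auto
      then have "norm (f (z + w)) powr p \<le> ?K * fock_density p f (z + w)"
        by (simp add: fock_density_def mult_ac)
      then have "norm (f (z + w)) \<le> 1 + ?K * fock_density p f (z + w)"
        using x[of "norm (f (z + w))"] by simp
      then have "ennreal (norm (f (z + w))) \<le> ennreal (1 + ?K * fock_density p f (z + w))"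
        by (rule ennreal_leI)
      then show ?thesis
        using True by (simp add: ennreal_plus ennreal_mult)
    qed simp
  qed
  also have "\<dots> = ennreal v + ennreal ?K * (\<integral>\<^sup>+w. fock_density p f (z + w) \<partial>lborel)"
    by (simp add: nn_integral_add nn_integral_cmult v)
  also have "(\<integral>\<^sup>+w. fock_density p f (z + w) \<partial>lborel) = (\<integral>\<^sup>+w. fock_density p f w \<partial>lborel)"
    by (subst (2) lborel_distr_plus[symmetric, of z], subst nn_integral_distr) auto
  also have "\<dots> = ennreal (LINT z|lborel. fock_density p f z)"
    using int by (intro nn_integral_eq_integral) auto
  finally have "ennreal (norm (f z) * v) \<le> ennreal (v + ?K * (LINT z|lborel. fock_density p f z))"
    using I0 by (simp add: v_def ennreal_mult ennreal_plus)
  then show ?thesis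
    by (subst (asm) ennreal_le_iff) (auto simp: v_def)
qed

text \<open>The disc estimate is not homogeneous, so it is applied to multiples
  \<open>t * f\<close>. Normalising to norm one gives the constant \<open>1 + K\<close>.\<close>

lemma fock_point_evaluation:
  assumes p: "1 \<le> p"
  obtains C where "0 \<le> C" "\<And>f. f \<in> fock_space p \<Longrightarrow> norm (f z) \<le> C * fock_norm p f"
proof -
  define v where "v = measure lborel (cball 0 1 :: complex set)"
  have v: "0 < v"
    by (simp add: v_def content_cball unit_ball_vol_pos)
  define K where "K = exp (p * (norm z + 1)\<^sup>2 / 2) * (2 * pi / p) / v"
  have K: "0 \<le> K"
    using v p by (simp add: K_def)
  have *: "t * norm (f z) \<le> 1 + K * (t * fock_norm p f) powr p" if f: "f \<in> fock_space p" and t: "0 < t" for f t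
  proof -
    have "t * fock_norm p f = fock_norm p (\<lambda>z. of_real t * f z)"
      using t p by (simp add: fock_norm_cmult)
    then have "(LINT z|lborel. fock_density p (\<lambda>z. of_real t * f z) z) = (2 * pi / p) * (t * fock_norm p f) powr p"
      using p by (simp add: fock_norm_powr)
    moreover have "norm (of_real t * f z) * v \<le> v + exp (p * (norm z + 1)\<^sup>2 / 2) *
        (LINT z|lborel. fock_density p (\<lambda>z. of_real t * f z) z)"
      unfolding v_def using norm_times_disc_le[OF p fock_space_cmult[OF f, of "of_real t"], of z] by simp
    ultimately have "t * norm (f z) * v \<le> (1 + K * (t * fock_norm p f) powr p) * v"
      using t v by (simp add: norm_mult K_def field_simps)
    then show ?thesis
      using v by simp
  qed
  show thesis
  proof (rule that[of "1 + K"])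
    fix f assume f: "f \<in> fock_space p"
    show "norm (f z) \<le> (1 + K) * fock_norm p f"
    proof (cases "fock_norm p f = 0")
      case True
      have "norm (f z) = 0"
      proof (rule ccontr)
        assume "norm (f z) \<noteq> 0"
        then show False
          \<comment> \<open>For norm zero the right-hand side of \<open>*\<close> is
            \<open>1\<close> for every \<open>t\<close>, while this \<open>t\<close> makes the
            left-hand side \<open>2\<close>.\<close>
          using *[OF f, of "2 / norm (f z)"] True by simp
      qed
      then show ?thesis
        using True by simp
    next
      case False
      then have "0 < fock_norm p f"
        using fock_norm_nonneg[of p f] by linarith
      then show ?thesis
        using *[OF f, of "1 / fock_norm p f"] by (simp add: field_simps)
    qed
  qed (use K in simp)
qed

text \<open>Definiteness comes from the point evaluations: norm zero forces every value to be zero,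
  not merely almost every one.\<close>

lemma fock_norm_eq_0_iff:
  assumes "1 \<le> p" "f \<in> fock_space p"
  shows "fock_norm p f = 0 \<longleftrightarrow> f = (\<lambda>z. 0)"
proof
  assume 0: "fock_norm p f = 0"
  show "f = (\<lambda>z. 0)"
  proof
    fix z
    obtain C where "norm (f z) \<le> C * fock_norm p f"
      using fock_point_evaluation[OF assms(1), of z] assms(2) by blast
    then show "f z = 0"
      using 0 by simp
  qed
qed simp

lemma fock_Metric_space:
  assumes "1 \<le> p"
  shows "Metric_space (fock_space p) (\<lambda>f g. fock_norm p (\<lambda>z. f z - g z))"
proof
  fix f g assume fg: "f \<in> fock_space p" "g \<in> fock_space p"
  show "fock_norm p (\<lambda>z. f z - g z) = 0 \<longleftrightarrow> f = g"
    using fock_norm_eq_0_iff[OF assms fock_space_diff[OF assms fg]] by (auto simp: fun_eq_iff)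
next
  fix f g h assume "f \<in> fock_space p" "g \<in> fock_space p" "h \<in> fock_space p"
  then show "fock_norm p (\<lambda>z. f z - h z) \<le> fock_norm p (\<lambda>z. f z - g z) + fock_norm p (\<lambda>z. g z - h z)"
    using fock_norm_triangle[OF assms, of "\<lambda>z. f z - g z" "\<lambda>z. g z - h z"] fock_space_diff[OF assms]
    by simp
qed (simp, rule fock_norm_commute)

section \<open>Pointwise limits inside compact sets\<close>

lemma fock_norm_tendsto_imp_pointwise:
  assumes p: "1 \<le> p" and "\<And>n. X n \<in> fock_space p" "h \<in> fock_space p"
    and lim: "(\<lambda>n. fock_norm p (\<lambda>z. X n z - h z)) \<longlonglongrightarrow> 0"
  shows "(\<lambda>n. X n z) \<longlonglongrightarrow> h z"
proof -
  obtain C where C: "\<And>f. f \<in> fock_space p \<Longrightarrow> norm (f z) \<le> C * fock_norm p f"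
    using fock_point_evaluation[OF p] by blast
  have "(\<lambda>n. X n z - h z) \<longlonglongrightarrow> 0"
  proof (rule Lim_null_comparison)
    show "\<forall>\<^sub>F n in sequentially. norm (X n z - h z) \<le> C * fock_norm p (\<lambda>z. X n z - h z)"
      using C fock_space_diff[OF p] assms by (intro always_eventually) blast
    show "(\<lambda>n. C * fock_norm p (\<lambda>z. X n z - h z)) \<longlonglongrightarrow> 0"
      using tendsto_mult_right_zero[OF lim] .
  qed
  then show ?thesis
    by (simp add: LIM_zero_iff)
qed

text \<open>Every subsequence has a norm convergent further subsequence. Norm convergence implies
  pointwise convergence, so all these norm limits equal \<open>h\<close>, and the whole sequence
  must converge to \<open>h\<close>.\<close>

lemma fock_compact_pointwise_limit:
  assumes p: "1 \<le> p" and K: "compactin (fock_topology p) K" and X: "\<And>n. X n \<in> K"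
    and lim: "\<And>z. (\<lambda>n. X n z) \<longlonglongrightarrow> h z"
  shows "h \<in> fock_space p" and "(\<lambda>n. fock_norm p (\<lambda>z. X n z - h z)) \<longlonglongrightarrow> 0"
proof -
  interpret Metric_space "fock_space p" "\<lambda>f g. fock_norm p (\<lambda>z. f z - g z)"
    by (rule fock_Metric_space[OF p])
  have KF: "K \<subseteq> fock_space p" and
    seq: "\<And>\<sigma> :: nat \<Rightarrow> _. range \<sigma> \<subseteq> K \<Longrightarrow> \<exists>l r. l \<in> K \<and> strict_mono r \<and> limitin mtopology (\<sigma> \<circ> r) l sequentially"
    using K unfolding fock_topology_def compactin_sequentially by auto
  \<comment> \<open>Stated for an arbitrary subsequence: \<open>id\<close> gives membership of
    \<open>h\<close>, and a subsequence staying at distance \<open>e\<close> from \<open>h\<close>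
    gives the contradiction.\<close>
  have sub: "h \<in> fock_space p \<and> (\<exists>s :: nat \<Rightarrow> nat. (\<lambda>n. fock_norm p (\<lambda>z. X (r (s n)) z - h z)) \<longlonglongrightarrow> 0)"
    if r: "strict_mono r" for r
  proof -
    obtain l s where l: "l \<in> K" and s: "strict_mono s" and "limitin mtopology ((X \<circ> r) \<circ> s) l sequentially"
      using seq[of "X \<circ> r"] X by auto
    then have l0: "(\<lambda>n. fock_norm p (\<lambda>z. X (r (s n)) z - l z)) \<longlonglongrightarrow> 0"
      by (simp add: limitin_metric_dist_null)
    have "l z = h z" for z
    proof (rule LIMSEQ_unique)
      show "(\<lambda>n. X (r (s n)) z) \<longlonglongrightarrow> l z"
        by (rule fock_norm_tendsto_imp_pointwise[OF p _ _ l0]) (use l X KF in auto)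
      show "(\<lambda>n. X (r (s n)) z) \<longlonglongrightarrow> h z"
        using LIMSEQ_subseq_LIMSEQ[OF lim strict_mono_o[OF r s], of z] by (simp add: o_def)
    qed
    then have "l = h" by auto
    with l KF l0 show ?thesis by auto
  qed
  show "h \<in> fock_space p"
    using sub[of id] by (simp add: strict_mono_id)
  show "(\<lambda>n. fock_norm p (\<lambda>z. X n z - h z)) \<longlonglongrightarrow> 0"
  proof (rule ccontr)
    assume "\<not> ?thesis"
    then obtain e where e: "0 < e" "\<And>N. \<exists>n\<ge>N. e \<le> fock_norm p (\<lambda>z. X n z - h z)"
      unfolding LIMSEQ_iff by (auto simp: not_less)
    then have "infinite {n. e \<le> fock_norm p (\<lambda>z. X n z - h z)}"
      by (auto simp: infinite_nat_iff_unbounded_le)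
    then obtain r :: "nat \<Rightarrow> nat" where r: "strict_mono r" "\<And>n. e \<le> fock_norm p (\<lambda>z. X (r n) z - h z)"
      using infinite_enumerate by blast
    then obtain s :: "nat \<Rightarrow> nat" where "(\<lambda>n. fock_norm p (\<lambda>z. X (r (s n)) z - h z)) \<longlonglongrightarrow> 0"
      using sub by blast
    then have "e \<le> 0"
      by (rule LIMSEQ_le_const) (use r in auto)
    with e show False by simp
  qed
qed

section \<open>Bounded operators and the operator norm\<close>

lemma fock_bounded_operatorD:
  assumes "fock_bounded_operator p T"
  shows "f \<in> fock_space p \<Longrightarrow> T f \<in> fock_space p"
    and "f \<in> fock_space p \<Longrightarrow> g \<in> fock_space p \<Longrightarrow> T (\<lambda>z. f z + g z) = (\<lambda>z. T f z + T g z)"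
    and "f \<in> fock_space p \<Longrightarrow> T (\<lambda>z. c * f z) = (\<lambda>z. c * T f z)"
  using assms by (auto simp: fock_bounded_operator_def)

lemma fock_bounded_operatorE:
  assumes "fock_bounded_operator p T"
  obtains C where "\<And>f. f \<in> fock_space p \<Longrightarrow> fock_norm p (T f) \<le> C * fock_norm p f"
  using assms unfolding fock_bounded_operator_def by blast

lemma fock_bounded_operator_funpow:
  assumes p: "1 \<le> p" and T: "fock_bounded_operator p T"
  shows "fock_bounded_operator p (T ^^ n)"
proof (induction n)
  case 0
  then show ?case
    by (auto simp: fock_bounded_operator_def intro: exI[of _ 1])
next
  case (Suc n)
  obtain C where C: "\<And>f. f \<in> fock_space p \<Longrightarrow> fock_norm p (T f) \<le> C * fock_norm p f"
    using fock_bounded_operatorE[OF T] by blast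
  obtain D where D: "\<And>f. f \<in> fock_space p \<Longrightarrow> fock_norm p ((T ^^ n) f) \<le> D * fock_norm p f"
    using fock_bounded_operatorE[OF Suc] by blast
  \<comment> \<open>The constant \<open>C\<close> may be negative; its absolute value keeps the
    multiplication monotone.\<close>
  have "fock_norm p (T ((T ^^ n) f)) \<le> (\<bar>C\<bar> * D) * fock_norm p f" if f: "f \<in> fock_space p" for f
  proof -
    have "fock_norm p (T ((T ^^ n) f)) \<le> C * fock_norm p ((T ^^ n) f)"
      using C fock_bounded_operatorD(1)[OF Suc f] by blast
    also have "\<dots> \<le> \<bar>C\<bar> * fock_norm p ((T ^^ n) f)"
      by (intro mult_right_mono) auto
    also have "\<dots> \<le> \<bar>C\<bar> * (D * fock_norm p f)"
      using D[OF f] by (intro mult_left_mono) auto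
    finally show ?thesis by simp
  qed
  then show ?case
    using fock_bounded_operatorD[OF T] fock_bounded_operatorD[OF Suc]
    by (auto simp: fock_bounded_operator_def intro!: exI[of _ "\<bar>C\<bar> * D"])
qed

text \<open>Normalise \<open>f\<close> into the unit ball. Boundedness of \<open>T\<close> makes the
  set under the real supremum bounded above, which is what turns \<open>fock_opnorm\<close> into an
  upper bound.\<close>

lemma fock_norm_le_opnorm:
  assumes p: "1 \<le> p" and T: "fock_bounded_operator p T" and f: "f \<in> fock_space p"
  shows "fock_norm p (T f) \<le> fock_opnorm p T * fock_norm p f"
proof (cases "fock_norm p f = 0")
  case True
  obtain C where C: "\<And>f. f \<in> fock_space p \<Longrightarrow> fock_norm p (T f) \<le> C * fock_norm p f"
    using fock_bounded_operatorE[OF T] by blast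
  show ?thesis
    using C[OF f] True by simp
next
  case False
  then have N: "0 < fock_norm p f"
    using fock_norm_nonneg[of p f] by linarith
  obtain C where C: "\<And>f. f \<in> fock_space p \<Longrightarrow> fock_norm p (T f) \<le> C * fock_norm p f"
    using fock_bounded_operatorE[OF T] by blast
  define c :: complex where "c = of_real (1 / fock_norm p f)"
  have c: "norm c = 1 / fock_norm p f"
    using N by (simp add: c_def norm_divide)
  have ball: "(\<lambda>z. c * f z) \<in> fock_unit_ball p"
    using f N by (simp add: fock_unit_ball_def fock_space_cmult fock_norm_cmult[OF p] c)
  have "bdd_above ((\<lambda>f. fock_norm p (T f)) ` fock_unit_ball p)"
  proof (rule bdd_aboveI2)
    fix g assume "g \<in> fock_unit_ball p"
    then have g: "g \<in> fock_space p" "fock_norm p g \<le> 1"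
      by (auto simp: fock_unit_ball_def)
    have "fock_norm p (T g) \<le> C * fock_norm p g"
      using C g by blast
    also have "\<dots> \<le> \<bar>C\<bar> * 1"
      using g by (intro mult_mono) auto
    finally show "fock_norm p (T g) \<le> \<bar>C\<bar>" by simp
  qed
  then have "fock_norm p (T (\<lambda>z. c * f z)) \<le> fock_opnorm p T"
    unfolding fock_opnorm_def using ball by (rule cSUP_upper[rotated])
  then show ?thesis
    using N by (simp add: fock_bounded_operatorD(3)[OF T f] fock_norm_cmult[OF p] c field_simps)
qed

lemma fock_power_boundedE:
  assumes p: "1 \<le> p" and T: "fock_power_bounded p T"
  obtains M where "0 \<le> M" "\<And>n f. f \<in> fock_space p \<Longrightarrow> fock_norm p ((T ^^ n) f) \<le> M * fock_norm p f"
proof -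
  obtain M where M: "\<And>n. fock_opnorm p (T ^^ n) \<le> M"
    using T by (auto simp: fock_power_bounded_def bdd_above_def)
  show thesis
  proof (rule that[of "\<bar>M\<bar>"])
    fix n f assume f: "f \<in> fock_space p"
    have "fock_norm p ((T ^^ n) f) \<le> fock_opnorm p (T ^^ n) * fock_norm p f"
      using T by (intro fock_norm_le_opnorm[OF p fock_bounded_operator_funpow[OF p] f])
        (simp add: fock_power_bounded_def)
    also have "\<dots> \<le> \<bar>M\<bar> * fock_norm p f"
      using M[of n] by (intro mult_right_mono) auto
    finally show "fock_norm p ((T ^^ n) f) \<le> \<bar>M\<bar> * fock_norm p f" .
  qed simp
qed

lemma fock_norm_sum_le:
  assumes p: "1 \<le> p" and "finite A" "\<And>k. k \<in> A \<Longrightarrow> F k \<in> fock_space p"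
  shows "(\<lambda>z. \<Sum>k\<in>A. F k z) \<in> fock_space p \<and> fock_norm p (\<lambda>z. \<Sum>k\<in>A. F k z) \<le> (\<Sum>k\<in>A. fock_norm p (F k))"
  using assms(2,3)
proof (induction A rule: finite_induct)
  case (insert k A)
  then have IH: "(\<lambda>z. \<Sum>k\<in>A. F k z) \<in> fock_space p"
      "fock_norm p (\<lambda>z. \<Sum>k\<in>A. F k z) \<le> (\<Sum>k\<in>A. fock_norm p (F k))"
    by auto
  show ?case
    using insert fock_space_add[OF p _ IH(1), of "F k"] fock_norm_triangle[OF p _ IH(1), of "F k"] IH(2)
    by (simp add: order_trans)
qed simp

section \<open>Powers of a compact power bounded operator\<close>

text \<open>The functional analytic core, separated from weighted composition. The map
  \<open>P\<close> enters only as the pointwise limit of the powers; its values in the Fock space,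
  its bound and its compatibility with differences are derived.\<close>

locale fock_compact_power_limit =
  fixes p :: real and T P :: "(complex \<Rightarrow> complex) \<Rightarrow> (complex \<Rightarrow> complex)"
  assumes p: "1 \<le> p" and compact: "fock_compact_operator p T" and power_bounded: "fock_power_bounded p T"
    and lim: "\<And>f z. f \<in> fock_space p \<Longrightarrow> (\<lambda>n. (T ^^ n) f z) \<longlonglongrightarrow> P f z"
begin

lemma bounded: "fock_bounded_operator p T"
  using compact by (simp add: fock_compact_operator_def)

lemmas funpow_bounded = fock_bounded_operator_funpow[OF p bounded]

lemma image_ball_subset_closure: "T ` fock_unit_ball p \<subseteq> fock_topology p closure_of (T ` fock_unit_ball p)"
  using fock_bounded_operatorD(1)[OF bounded]
  by (intro closure_of_subset)
    (auto simp: fock_topology_def fock_unit_ball_def Metric_space.topspace_mtopology[OF fock_Metric_space[OF p]])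

text \<open>By power boundedness one scalar \<open>s\<close> puts every
  \<open>s * (T ^^ n) f\<close> into the unit ball. One more application of \<open>T\<close> moves
  the sequence into the compact closure, where pointwise convergence becomes norm
  convergence.\<close>

lemma strong_limit:
  assumes f: "f \<in> fock_space p"
  shows "P f \<in> fock_space p" and "(\<lambda>n. fock_norm p (\<lambda>z. (T ^^ n) f z - P f z)) \<longlonglongrightarrow> 0"
proof -
  obtain M where M: "0 \<le> M" "\<And>n f. f \<in> fock_space p \<Longrightarrow> fock_norm p ((T ^^ n) f) \<le> M * fock_norm p f"
    using fock_power_boundedE[OF p power_bounded] by blast
  \<comment> \<open>The summand \<open>1\<close> keeps \<open>t\<close> positive, so that
    \<open>s = 1 / t\<close> is a legitimate scaling.\<close>
  define t where "t = M * fock_norm p f + 1"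
  have t: "0 < t" "M * fock_norm p f \<le> t"
    using M(1) by (auto simp: t_def intro: add_nonneg_pos)
  define s :: complex where "s = of_real (1 / t)"
  have s: "s \<noteq> 0" "norm s = 1 / t"
    using t by (auto simp: s_def norm_divide)
  define X where "X n = (\<lambda>z. s * (T ^^ Suc n) f z)" for n
  have K: "compactin (fock_topology p) (fock_topology p closure_of (T ` fock_unit_ball p))"
    using compact by (simp add: fock_compact_operator_def)
  have X: "X n \<in> fock_topology p closure_of (T ` fock_unit_ball p)" for n
  proof -
    have "(\<lambda>z. s * (T ^^ n) f z) \<in> fock_unit_ball p"
      using M(2)[OF f, of n] t fock_bounded_operatorD(1)[OF funpow_bounded f, of n]
      by (simp add: fock_unit_ball_def fock_space_cmult fock_norm_cmult[OF p] s field_simps)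
    moreover have "X n = T (\<lambda>z. s * (T ^^ n) f z)"
      using fock_bounded_operatorD(1)[OF funpow_bounded f, of n]
      by (simp add: X_def fock_bounded_operatorD(3)[OF bounded])
    ultimately show ?thesis
      using image_ball_subset_closure by blast
  qed
  have Xlim: "(\<lambda>n. X n z) \<longlonglongrightarrow> s * P f z" for z
    unfolding X_def using LIMSEQ_Suc[OF lim[OF f, of z]] by (intro tendsto_intros)
  note * = fock_compact_pointwise_limit[OF p K X Xlim]
  show "P f \<in> fock_space p"
    using fock_space_cmult[OF *(1), of "1 / s"] s by simp
  have "(\<lambda>n. norm (1 / s) * fock_norm p (\<lambda>z. X n z - s * P f z)) \<longlonglongrightarrow> 0"
    using tendsto_mult_right_zero[OF *(2)] .
  moreover have "norm (1 / s) * fock_norm p (\<lambda>z. X n z - s * P f z)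
      = fock_norm p (\<lambda>z. (T ^^ Suc n) f z - P f z)" for n
  proof -
    have "(\<lambda>z. (T ^^ Suc n) f z - P f z) = (\<lambda>z. (1 / s) * (X n z - s * P f z))"
      using s by (auto simp: X_def field_simps)
    then show ?thesis
      by (simp only: fock_norm_cmult[OF p])
  qed
  ultimately show "(\<lambda>n. fock_norm p (\<lambda>z. (T ^^ n) f z - P f z)) \<longlonglongrightarrow> 0"
    by (intro LIMSEQ_imp_Suc[of "\<lambda>n. fock_norm p (\<lambda>z. (T ^^ n) f z - P f z)"]) simp
qed

text \<open>The uniform bound on the powers survives the strong limit, so a single \<open>M\<close>
  serves both the powers and \<open>P\<close>.\<close>

lemma limit_bounded:
  obtains M where "0 \<le> M" "\<And>n f. f \<in> fock_space p \<Longrightarrow> fock_norm p ((T ^^ n) f) \<le> M * fock_norm p f"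
    "\<And>f. f \<in> fock_space p \<Longrightarrow> fock_norm p (P f) \<le> M * fock_norm p f"
proof -
  obtain M where M: "0 \<le> M" "\<And>n f. f \<in> fock_space p \<Longrightarrow> fock_norm p ((T ^^ n) f) \<le> M * fock_norm p f"
    using fock_power_boundedE[OF p power_bounded] by blast
  have "fock_norm p (P f) \<le> M * fock_norm p f" if f: "f \<in> fock_space p" for f
  proof (rule LIMSEQ_le_const)
    show "(\<lambda>n. fock_norm p (\<lambda>z. (T ^^ n) f z - P f z) + M * fock_norm p f) \<longlonglongrightarrow> M * fock_norm p f"
      using tendsto_add[OF strong_limit(2)[OF f] tendsto_const] by simp
    have "fock_norm p (P f) \<le> fock_norm p (\<lambda>z. (T ^^ n) f z - P f z) + M * fock_norm p f" for n
    proof -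
      note TF = fock_bounded_operatorD(1)[OF funpow_bounded f, of n]
      have "fock_norm p (P f) \<le> fock_norm p ((T ^^ n) f) + fock_norm p (\<lambda>z. (T ^^ n) f z - P f z)"
        using fock_norm_diff_triangle[OF p TF fock_space_diff[OF p TF strong_limit(1)[OF f]]] by simp
      then show ?thesis
        using M(2)[OF f, of n] by simp
    qed
    then show "\<exists>N. \<forall>n\<ge>N. fock_norm p (P f) \<le> fock_norm p (\<lambda>z. (T ^^ n) f z - P f z) + M * fock_norm p f"
      by blast
  qed
  with M show thesis
    using that by blast
qed

lemma limit_bound: "\<exists>M. \<forall>f\<in>fock_space p. fock_norm p (P f) \<le> M * fock_norm p f"
  using limit_bounded by metis

text \<open>Linearity of the powers passes to \<open>P\<close> by uniqueness of pointwise
  limits.\<close>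

lemma limit_diff:
  assumes f: "f \<in> fock_space p" and g: "g \<in> fock_space p"
  shows "(T ^^ n) (\<lambda>z. f z - g z) = (\<lambda>z. (T ^^ n) f z - (T ^^ n) g z)"
    and "P (\<lambda>z. f z - g z) = (\<lambda>z. P f z - P g z)"
proof -
  show T: "(T ^^ n) (\<lambda>z. f z - g z) = (\<lambda>z. (T ^^ n) f z - (T ^^ n) g z)" for n
    using fock_bounded_operatorD(2)[OF funpow_bounded f fock_space_cmult[OF g], of n "-1"]
      fock_bounded_operatorD(3)[OF funpow_bounded g, of n "-1"] by simp
  show "P (\<lambda>z. f z - g z) = (\<lambda>z. P f z - P g z)"
  proof
    fix z
    show "P (\<lambda>z. f z - g z) z = P f z - P g z"
    proof (rule LIMSEQ_unique)
      show "(\<lambda>n. (T ^^ n) (\<lambda>z. f z - g z) z) \<longlonglongrightarrow> P (\<lambda>z. f z - g z) z"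
        by (rule lim[OF fock_space_diff[OF p f g]])
      show "(\<lambda>n. (T ^^ n) (\<lambda>z. f z - g z) z) \<longlonglongrightarrow> P f z - P g z"
        unfolding T by (intro tendsto_intros lim f g)
    qed
  qed
qed

text \<open>The powers applied to \<open>T f\<close> form the shifted sequence of the powers applied
  to \<open>f\<close>.\<close>

lemma limit_absorbs:
  assumes f: "f \<in> fock_space p"
  shows "P (T f) = P f"
proof
  fix z
  show "P (T f) z = P f z"
    using lim[OF fock_bounded_operatorD(1)[OF bounded f], of z] LIMSEQ_Suc[OF lim[OF f, of z]]
    by (intro LIMSEQ_unique) (simp_all add: funpow_swap1)
qed

text \<open>Strong convergence of an equicontinuous sequence is uniform on the totally bounded image of
  the unit ball under \<open>T\<close>.\<close>

lemma uniform_limit_ball: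
  assumes e: "0 < e"
  shows "\<exists>N. \<forall>n\<ge>N. \<forall>f\<in>fock_unit_ball p. fock_norm p (\<lambda>z. (T ^^ n) f z - P f z) \<le> e"
proof -
  interpret Metric_space "fock_space p" "\<lambda>f g. fock_norm p (\<lambda>z. f z - g z)"
    by (rule fock_Metric_space[OF p])
  obtain M where M: "0 \<le> M" "\<And>n f. f \<in> fock_space p \<Longrightarrow> fock_norm p ((T ^^ n) f) \<le> M * fock_norm p f"
    "\<And>f. f \<in> fock_space p \<Longrightarrow> fock_norm p (P f) \<le> M * fock_norm p f"
    using limit_bounded by blast
  \<comment> \<open>The radius makes the error \<open>2 * M * d\<close> at most
    \<open>e / 2\<close>; \<open>M + 1\<close> avoids division by zero.\<close>
  define d where "d = e / (4 * (M + 1))"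
  have d: "0 < d" "2 * M * d \<le> e / 2"
    using e M(1) by (auto simp: d_def field_simps)
  have "mtotally_bounded (fock_topology p closure_of (T ` fock_unit_ball p))"
    using compact by (simp add: fock_compact_operator_def fock_topology_def compactin_imp_mtotally_bounded)
  then obtain K where K: "finite K" "T ` fock_unit_ball p \<subseteq> (\<Union>x\<in>K. mball x d)"
    using d(1) image_ball_subset_closure unfolding mtotally_bounded_def by (meson order_trans)
  \<comment> \<open>Strong convergence is uniform over the finitely many ball centres.\<close>
  have "\<forall>\<^sub>F n in sequentially. \<forall>x\<in>K \<inter> fock_space p. fock_norm p (\<lambda>z. (T ^^ n) x z - P x z) < e / 2"
  proof (intro eventually_ball_finite ballI)
    fix x assume "x \<in> K \<inter> fock_space p"
    then show "\<forall>\<^sub>F n in sequentially. fock_norm p (\<lambda>z. (T ^^ n) x z - P x z) < e / 2"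
      using e by (intro order_tendstoD(2)[OF strong_limit(2)]) auto
  qed (use K(1) in simp)
  then obtain N where N: "\<And>n x. n \<ge> N \<Longrightarrow> x \<in> K \<Longrightarrow> x \<in> fock_space p \<Longrightarrow>
      fock_norm p (\<lambda>z. (T ^^ n) x z - P x z) < e / 2"
    unfolding eventually_sequentially by blast
  have "fock_norm p (\<lambda>z. (T ^^ Suc n) f z - P f z) \<le> e" if n: "n \<ge> N" and f: "f \<in> fock_unit_ball p" for n f
  proof -
    have fF: "f \<in> fock_space p"
      using f by (simp add: fock_unit_ball_def)
    obtain x where x: "x \<in> K" "T f \<in> mball x d"
      using K f by blast
    then have xF: "x \<in> fock_space p" and TfF: "T f \<in> fock_space p"
      and dist: "fock_norm p (\<lambda>z. T f z - x z) < d"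
      by (auto simp: in_mball fock_norm_commute)
    define g where "g = (\<lambda>z. T f z - x z)"
    have g: "g \<in> fock_space p" "fock_norm p g \<le> d"
      using dist fock_space_diff[OF p TfF xF] by (auto simp: g_def)
    note F = fock_bounded_operatorD(1)[OF funpow_bounded] strong_limit(1)
    \<comment> \<open>Since \<open>P f = P (T f)\<close>, the difference is
      \<open>T ^^ n - P\<close> applied to \<open>T f = g + x\<close>: the part \<open>g\<close> is
      small by the uniform bound \<open>2 * M\<close>, the centre \<open>x\<close> by the choice of
      \<open>N\<close>.\<close>
    have "(\<lambda>z. (T ^^ Suc n) f z - P f z) = (\<lambda>z. ((T ^^ n) g z - P g z) + ((T ^^ n) x z - P x z))"
      by (simp add: g_def limit_diff[OF TfF xF] limit_absorbs[OF fF] funpow_swap1)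
    then have "fock_norm p (\<lambda>z. (T ^^ Suc n) f z - P f z)
        \<le> fock_norm p (\<lambda>z. (T ^^ n) g z - P g z) + fock_norm p (\<lambda>z. (T ^^ n) x z - P x z)"
      using fock_norm_triangle[OF p fock_space_diff[OF p F(1)[OF g(1)] F(2)[OF g(1)]]
        fock_space_diff[OF p F(1)[OF xF] F(2)[OF xF]], of n n] by simp
    also have "fock_norm p (\<lambda>z. (T ^^ n) g z - P g z) \<le> M * fock_norm p g + M * fock_norm p g"
      using fock_norm_diff_triangle[OF p F(1)[OF g(1)] F(2)[OF g(1)], of n] M(2)[OF g(1), of n] M(3)[OF g(1)]
      by linarith
    also have "\<dots> \<le> 2 * M * d"
      using mult_left_mono[OF g(2) M(1)] by simp
    also have "\<dots> \<le> e / 2" by (rule d)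
    finally show ?thesis
      using N[OF n x(1) xF] by simp
  qed
  note step = this
  show ?thesis
  proof (intro exI[of _ "Suc N"] allI impI ballI)
    fix n f assume "Suc N \<le> n" and f: "f \<in> fock_unit_ball p"
    then obtain m where "n = Suc m" "N \<le> m"
      by (cases n) auto
    then show "fock_norm p (\<lambda>z. (T ^^ n) f z - P f z) \<le> e"
      using step f by blast
  qed
qed

text \<open>From index \<open>N\<close> on, every power is within \<open>e / 2\<close> of
  \<open>P\<close> on the unit ball. Fewer than \<open>N\<close> earlier terms occur in the mean,
  each with error at most \<open>2 * M\<close>, so after division by \<open>n\<close> they become
  negligible.\<close>

lemma cesaro_limit:
  "(\<lambda>n. fock_opnorm p (\<lambda>f z. (1 / of_nat n) * (\<Sum>k=1..n. (T ^^ k) f z) - P f z)) \<longlonglongrightarrow> 0"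
proof -
  obtain M where M: "0 \<le> M" "\<And>n f. f \<in> fock_space p \<Longrightarrow> fock_norm p ((T ^^ n) f) \<le> M * fock_norm p f"
    "\<And>f. f \<in> fock_space p \<Longrightarrow> fock_norm p (P f) \<le> M * fock_norm p f"
    using limit_bounded by blast
  define D where "D n f = (\<lambda>z. (1 / of_nat n) * (\<Sum>k=1..n. (T ^^ k) f z) - P f z)" for n :: nat and f
  have zero_ball: "(\<lambda>z. 0) \<in> fock_unit_ball p"
    by (simp add: fock_unit_ball_def)
  have "\<exists>N. \<forall>n\<ge>N. norm (fock_opnorm p (D n)) \<le> e" if e: "0 < e" for e
  proof -
    obtain N where N: "\<And>n f. n \<ge> N \<Longrightarrow> f \<in> fock_unit_ball p \<Longrightarrow> fock_norm p (\<lambda>z. (T ^^ n) f z - P f z) \<le> e / 2"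
      using uniform_limit_ball[of "e / 2"] e by auto
    \<comment> \<open>For \<open>n\<close> at least \<open>L\<close>, the early terms contribute at
      most \<open>2 * M * N / n \<le> e / 2\<close>. As \<open>L\<close> may be \<open>0\<close>,
      the bound below starts at \<open>max 1 L\<close>.\<close>
    obtain L :: nat where L: "2 * M * real N / (e / 2) \<le> real L"
      using real_arch_simple by blast
    have bound: "fock_norm p (D n f) \<le> e" if n: "n \<ge> max 1 L" and f: "f \<in> fock_unit_ball p" for n f
    proof -
      have n0: "0 < real n"
        using n by simp
      have "2 * M * real N / (e / 2) \<le> real n"
        using n L by (meson max.boundedE of_nat_mono order_trans)
      then have nL: "2 * M * real N \<le> real n * (e / 2)"
        using e by (subst (asm) pos_divide_le_eq) auto
      have fF: "f \<in> fock_space p" and f1: "fock_norm p f \<le> 1"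
        using f by (auto simp: fock_unit_ball_def)
      define E where "E k = (\<lambda>z. (T ^^ k) f z - P f z)" for k
      have EF: "E k \<in> fock_space p" for k
        unfolding E_def by (intro fock_space_diff[OF p] fock_bounded_operatorD(1)[OF funpow_bounded] strong_limit fF)
      have Ebound: "fock_norm p (E k) \<le> e / 2 + (if k < N then 2 * M else 0)" for k
      proof (cases "k < N")
        case True
        have "fock_norm p (E k) \<le> M * fock_norm p f + M * fock_norm p f"
          using fock_norm_diff_triangle[OF p fock_bounded_operatorD(1)[OF funpow_bounded fF] strong_limit(1)[OF fF], of k]
            M(2)[OF fF, of k] M(3)[OF fF] by (simp add: E_def)
        also have "\<dots> \<le> 2 * M"
          using mult_left_mono[OF f1 M(1)] by simp
        finally show ?thesis
          using True e by simp
      qed (use N[OF _ f] in \<open>auto simp: E_def not_less\<close>)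
      have "D n f = (\<lambda>z. (1 / of_nat n) * (\<Sum>k=1..n. E k z))"
        using n0 by (auto simp: D_def E_def sum_subtractf field_simps)
      then have "fock_norm p (D n f) = 1 / real n * fock_norm p (\<lambda>z. \<Sum>k=1..n. E k z)"
        by (simp only: fock_norm_cmult[OF p]) (simp add: norm_divide)
      also have "\<dots> \<le> 1 / real n * (\<Sum>k=1..n. fock_norm p (E k))"
        using fock_norm_sum_le[OF p, of "{1..n}" E] EF by (intro mult_left_mono) auto
      also have "(\<Sum>k=1..n. fock_norm p (E k)) \<le> (\<Sum>k=1..n. e / 2 + (if k < N then 2 * M else 0))"
        by (intro sum_mono Ebound)
      also have "\<dots> = real n * (e / 2) + real (card ({1..n} \<inter> {k. k < N})) * (2 * M)"
        by (simp add: sum.distrib sum.If_cases)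
      also have "\<dots> \<le> real n * (e / 2) + real N * (2 * M)"
      proof -
        have "card ({1..n} \<inter> {k. k < N}) \<le> card {..<N}"
          by (intro card_mono) auto
        then show ?thesis
          using M(1) by (intro add_left_mono mult_right_mono) auto
      qed
      also have "\<dots> \<le> real n * e"
        using nL by (simp add: mult_ac)
      finally show ?thesis
        using n0 by (simp add: divide_right_mono)
    qed
    have "norm (fock_opnorm p (D n)) \<le> e" if n: "n \<ge> max 1 L" for n
    proof -
      \<comment> \<open>The zero function makes the unit ball nonempty, and its image gives the
        lower bound \<open>0\<close> needed for the absolute value of the supremum.\<close>
      have "fock_opnorm p (D n) \<le> e"
        unfolding fock_opnorm_def using zero_ball bound[OF n] by (intro cSUP_least) auto
      moreover have "fock_norm p (D n (\<lambda>z. 0)) \<le> fock_opnorm p (D n)"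
        unfolding fock_opnorm_def using zero_ball bound[OF n] by (intro cSUP_upper bdd_aboveI2) auto
      ultimately show ?thesis
        using fock_norm_nonneg[of p "D n (\<lambda>z. 0)"] unfolding real_norm_def by linarith
    qed
    then show ?thesis by blast
  qed
  note small = this
  have "(\<lambda>n. fock_opnorm p (D n)) \<longlonglongrightarrow> 0"
  proof (rule LIMSEQ_I)
    fix r :: real assume r: "0 < r"
    then obtain N where "\<forall>n\<ge>N. norm (fock_opnorm p (D n)) \<le> r / 2"
      using small[of "r / 2"] by auto
    then show "\<exists>N. \<forall>n\<ge>N. norm (fock_opnorm p (D n) - 0) < r"
      using r by (intro exI[of _ N]) force
  qed
  then show ?thesis
    by (simp only: D_def[abs_def])
qed

end

section \<open>Weighted composition operators with affine symbol\<close>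

text \<open>In the coordinate centred at the fixed point \<open>z0\<close>, the map is
  multiplication by \<open>a\<close>.\<close>

lemma funpow_affine:
  fixes a b z0 :: complex
  assumes "\<And>z. \<psi> z = a * z + b" "\<psi> z0 = z0"
  shows "(\<psi> ^^ n) z = z0 + a ^ n * (z - z0)"
proof (induction n)
  case (Suc n)
  have "\<psi> (z0 + w) = \<psi> z0 + a * w" for w
    by (simp add: assms(1) algebra_simps)
  then show ?case
    using Suc assms(2) by simp
qed simp

lemma funpow_weighted_comp:
  "(weighted_comp u \<psi> ^^ n) f z = (\<Prod>j<n. u ((\<psi> ^^ j) z)) * f ((\<psi> ^^ n) z)"
proof (induction n arbitrary: f)
  case (Suc n)
  \<comment> \<open>The innermost application is split off, so the induction hypothesis for
    \<open>weighted_comp u \<psi> f\<close> supplies the new factor at the end of the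
    product.\<close>
  have eq: "(weighted_comp u \<psi> ^^ Suc n) f z = (weighted_comp u \<psi> ^^ n) (weighted_comp u \<psi> f) z"
    by (simp only: funpow_Suc_right o_apply)
  show ?case
    unfolding eq Suc by (simp add: weighted_comp_def mult.assoc)
qed simp

lemma affine_orbit_tendsto:
  fixes a z z0 :: complex
  assumes "norm a < 1"
  shows "(\<lambda>n. z0 + a ^ n * (z - z0)) \<longlonglongrightarrow> z0"
  using tendsto_add[OF tendsto_const tendsto_mult_left_zero[OF LIMSEQ_power_zero[OF assms]], of z0 "z - z0"]
  by simp

text \<open>The factors satisfy \<open>\<bar>u(\<psi>\<^sup>j z) - 1\<bar> \<le> C \<bar>a\<bar>\<^sup>j \<bar>z - z0\<bar>\<close> because \<open>u\<close> is differentiable at the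
  fixed point.\<close>

lemma convergent_orbit_product:
  fixes u :: "complex \<Rightarrow> complex"
  assumes u: "u holomorphic_on UNIV" and u0: "u z0 = 1" and a: "norm a < 1"
  shows "convergent (\<lambda>n. \<Prod>j<n. u (z0 + a ^ j * (z - z0)))"
proof -
  define w where "w j = z0 + a ^ j * (z - z0)" for j
  obtain D where D: "(u has_field_derivative D) (at z0)"
    using u by (auto simp: holomorphic_on_def field_differentiable_def)
  then have "((\<lambda>v. norm ((u v - u z0) / (v - z0))) \<longlongrightarrow> norm D) (at z0)"
    unfolding has_field_derivative_iff by (rule tendsto_norm)
  then have "\<forall>\<^sub>F v in at z0. norm ((u v - u z0) / (v - z0)) < norm D + 1"
    by (rule order_tendstoD) simp
  \<comment> \<open>Multiplying out the quotient makes the bound hold at \<open>v = z0\<close> as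
    well. The full neighbourhood matters because the orbit may hit \<open>z0\<close>.\<close>
  then have "\<forall>\<^sub>F v in nhds z0. norm (u v - 1) \<le> (norm D + 1) * norm (v - z0)"
    unfolding eventually_at_filter
    by eventually_elim (auto simp: u0 norm_divide divide_less_eq)
  moreover have "w \<longlonglongrightarrow> z0"
    unfolding w_def[abs_def] by (rule affine_orbit_tendsto[OF a])
  ultimately have "\<forall>\<^sub>F j in sequentially. norm (u (w j) - 1) \<le> (norm D + 1) * norm (w j - z0)"
    by (rule eventually_compose_filterlim)
  then have "\<forall>\<^sub>F j in sequentially. norm (norm (u (w j) - 1)) \<le> (norm D + 1) * norm (z - z0) * norm a ^ j"
    by eventually_elim (simp add: w_def norm_mult norm_power mult_ac)
  then have "summable (\<lambda>j. norm (u (w j) - 1))"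
    by (rule summable_comparison_test_ev) (use a in \<open>auto intro!: summable_mult summable_geometric\<close>)
  then have "convergent (\<lambda>n. \<Prod>j\<le>n. u (w j))"
    by (intro convergent_prod_imp_convergent abs_convergent_prod_imp_convergent_prod)
      (simp add: abs_convergent_prod_conv_summable)
  then show ?thesis
    unfolding convergent_def w_def by (simp add: LIMSEQ_lessThan_iff_atMost)
qed

text \<open>The first two conjuncts give the third its intended meaning: the \<open>lim\<close> in
  \<open>u_infinity\<close> is a true limit, and the limit operator is bounded, so the differences
  are bounded too and \<open>fock_opnorm\<close> is their operator norm.\<close>

theorem theorem4p2:
  fixes p :: real and u \<psi> :: "complex \<Rightarrow> complex" and a b z0 :: complex
  assumes "1 \<le> p"
    and "u holomorphic_on UNIV" and "\<psi> holomorphic_on UNIV"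
    and "fock_compact_operator p (weighted_comp u \<psi>)"
    and "fock_power_bounded p (weighted_comp u \<psi>)"
    and "\<And>z. \<psi> z = a * z + b" and "norm a < 1"
    and "\<And>z. u z \<noteq> 0"
    and "z0 = b / (1 - a)" and "u z0 = 1"
  shows "(\<forall>z. (\<lambda>n. \<Prod>j<n. u ((\<psi> ^^ j) z)) \<longlonglongrightarrow> u_infinity u \<psi> z) \<and>
    fock_bounded_operator p (weighted_comp (u_infinity u \<psi>) (\<lambda>_. z0)) \<and>
    (\<lambda>n. fock_opnorm p (\<lambda>f z.
        (1 / of_nat n) * (\<Sum>k=1..n. (weighted_comp u \<psi> ^^ k) f z)
        - weighted_comp (u_infinity u \<psi>) (\<lambda>_. z0) f z)) \<longlonglongrightarrow> 0"
proof -
  have "a \<noteq> 1"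
    using assms(7) by auto
  then have "\<psi> z0 = z0"
    unfolding assms(6,9) by (simp add: field_simps)
  note orbit = funpow_affine[OF assms(6) this]
  have prod: "(\<lambda>n. \<Prod>j<n. u ((\<psi> ^^ j) z)) \<longlonglongrightarrow> u_infinity u \<psi> z" for z
    using convergent_orbit_product[OF assms(2,10,7), of z]
    unfolding u_infinity_def orbit convergent_LIMSEQ_iff .
  interpret fock_compact_power_limit p "weighted_comp u \<psi>" "weighted_comp (u_infinity u \<psi>) (\<lambda>_. z0)"
  proof (rule fock_compact_power_limit.intro[OF assms(1,4,5)])
    fix f z assume "f \<in> fock_space p"
    then have "isCont f z0"
      using holomorphic_on_imp_continuous_on[of f UNIV]
      by (auto simp: fock_space_iff continuous_on_eq_continuous_at)
    moreover have "(\<lambda>n. (\<psi> ^^ n) z) \<longlonglongrightarrow> z0"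
      unfolding orbit by (rule affine_orbit_tendsto[OF assms(7)])
    ultimately have "(\<lambda>n. f ((\<psi> ^^ n) z)) \<longlonglongrightarrow> f z0"
      by (rule isCont_tendsto_compose)
    from tendsto_mult[OF prod this]
    show "(\<lambda>n. (weighted_comp u \<psi> ^^ n) f z) \<longlonglongrightarrow> weighted_comp (u_infinity u \<psi>) (\<lambda>_. z0) f z"
      by (simp only: funpow_weighted_comp weighted_comp_def[of "u_infinity u \<psi>"])
  qed
  \<comment> \<open>Additivity and homogeneity are visible in the formula. That the values are
    entire and of finite norm comes from the norm limit of the powers.\<close>
  have "fock_bounded_operator p (weighted_comp (u_infinity u \<psi>) (\<lambda>_. z0))"
    unfolding fock_bounded_operator_def
    using strong_limit(1) limit_bound by (simp add: weighted_comp_def algebra_simps)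
  with prod cesaro_limit show ?thesis
    by simp
qed

end
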